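(* Assume values are i.i.d. with a regular distribution $F$ on $[0,\bar v]$ whose density $f > 0$ is continuously differentiable, and $2 \le k < n$. Then there exists a payment rule $P : [0,\bar v]^n \to [0,\infty)^n$ (non-negative payments) that implements the efficient allocation rule, satisfies interim individual rationality, charges zero to every bidder not among the $k$ highest values, and whose total revenue $\sum_i P_i(\bm v)$ is almost surely constant (so the revenue variance is zero).
   Context: Setting: $n$ risk-neutral unit-demand bidders and $k$ identical items. Values $v_1,\dots,v_n$ are i.i.d. on $[0,\bar v]$ with CDF $F$ and density $f>0$. The virtual value function is $\phi(v) = v - \frac{1-F(v)}{f(v)}$; $F$ is regular if $\phi$ is strictly increasing. The efficient allocation rule gives one item to each of the $k$ bidders with the highest values (ties, a probability-zero event, broken by any fixed rule). For an allocation rule $A$, $x_i(v_i) = \mathbb E[A_i(\bm v)\mid v_i]$ and $z_i(v_i) = v_i x_i(v_i) - \int_0^{v_i} x_i(u)\,du$. A payment rule $P$ implements $A$ if $(A,P)$ is Bayesian incentive compatible, i.e. $\mathbb E[v_i A_i(\bm v) - P_i(\bm v) \mid v_i] \ge \mathbb E[v_i A_i(v_i',\bm v_{-i}) - P_i(v_i',\bm v_{-i}) \mid v_i]$ for all $i,v_i,v_i'$, and $\mathbb E[P_i(\bm v)\mid v_i] = z_i(v_i)$ for all $i, v_i$. Interim individual rationality: $\mathbb E[v_iA_i(\bm v) - P_i(\bm v)\mid v_i] \ge 0$ for all $i, v_i$. *)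

theory Defs
  imports "HOL-Probability.Probability"
begin

definition val_measure :: "real \<Rightarrow> (real \<Rightarrow> real) \<Rightarrow> real measure" where
  "val_measure vbar f = density lborel (\<lambda>x. ennreal (f x * indicator {0..vbar} x))"

definition profile_measure :: "nat \<Rightarrow> real \<Rightarrow> (real \<Rightarrow> real) \<Rightarrow> (nat \<Rightarrow> real) measure" where
  "profile_measure n vbar f = PiM {..<n} (\<lambda>_. val_measure vbar f)"

definition cdf_of :: "(real \<Rightarrow> real) \<Rightarrow> real \<Rightarrow> real" where
  "cdf_of f x = integral {0..x} f"

definition virtual_value :: "(real \<Rightarrow> real) \<Rightarrow> real \<Rightarrow> real" where
  "virtual_value f v = v - (1 - cdf_of f v) / f v"

definition regular :: "real \<Rightarrow> (real \<Rightarrow> real) \<Rightarrow> bool" where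
  "regular vbar f \<longleftrightarrow> strict_mono_on {0..vbar} (virtual_value f)"

definition efficient_alloc :: "nat \<Rightarrow> nat \<Rightarrow> (nat \<Rightarrow> real) \<Rightarrow> nat \<Rightarrow> real" where
  "efficient_alloc n k v i =
     (if i < n \<and> card {j\<in>{..<n}. v i < v j \<or> (v j = v i \<and> j < i)} < k then 1 else 0)"

text \<open>Interim expectation E[g(v) | v_i = x]: by independence, integrate over the
  profile with coordinate i replaced by x.\<close>
definition interim :: "(nat \<Rightarrow> real) measure \<Rightarrow> ((nat \<Rightarrow> real) \<Rightarrow> real) \<Rightarrow> nat \<Rightarrow> real \<Rightarrow> real" where
  "interim M g i x = (\<integral>v. g (v(i := x)) \<partial>M)"

definition interim_alloc :: "nat \<Rightarrow> nat \<Rightarrow> real \<Rightarrow> (real \<Rightarrow> real) \<Rightarrow> nat \<Rightarrow> real \<Rightarrow> real" where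
  "interim_alloc n k vbar f i x = interim (profile_measure n vbar f) (\<lambda>v. efficient_alloc n k v i) i x"

definition z_fun :: "nat \<Rightarrow> nat \<Rightarrow> real \<Rightarrow> (real \<Rightarrow> real) \<Rightarrow> nat \<Rightarrow> real \<Rightarrow> real" where
  "z_fun n k vbar f i x = x * interim_alloc n k vbar f i x - integral {0..x} (interim_alloc n k vbar f i)"

definition implements_efficient ::
  "nat \<Rightarrow> nat \<Rightarrow> real \<Rightarrow> (real \<Rightarrow> real) \<Rightarrow> ((nat \<Rightarrow> real) \<Rightarrow> nat \<Rightarrow> real) \<Rightarrow> bool" where
  "implements_efficient n k vbar f P \<longleftrightarrow>
     (\<forall>i<n.
        (\<lambda>v. P v i) \<in> borel_measurable (profile_measure n vbar f) \<and>
        (\<forall>x\<in>{0..vbar}. integrable (profile_measure n vbar f) (\<lambda>v. P (v(i := x)) i)) \<and>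
        (\<forall>x\<in>{0..vbar}. \<forall>x'\<in>{0..vbar}.
            interim (profile_measure n vbar f) (\<lambda>v. x * efficient_alloc n k v i - P v i) i x
          \<ge> interim (profile_measure n vbar f) (\<lambda>v. x * efficient_alloc n k v i - P v i) i x') \<and>
        (\<forall>x\<in>{0..vbar}. interim (profile_measure n vbar f) (\<lambda>v. P v i) i x = z_fun n k vbar f i x))"

definition interim_IR ::
  "nat \<Rightarrow> nat \<Rightarrow> real \<Rightarrow> (real \<Rightarrow> real) \<Rightarrow> ((nat \<Rightarrow> real) \<Rightarrow> nat \<Rightarrow> real) \<Rightarrow> bool" where
  "interim_IR n k vbar f P \<longleftrightarrow>
     (\<forall>i<n. \<forall>x\<in>{0..vbar}.
        interim (profile_measure n vbar f) (\<lambda>v. x * efficient_alloc n k v i - P v i) i x \<ge> 0)"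

end

(*
  The payments depend only on the k-th highest value y: the lowest winner pays B(y) and each of the
  other k - 1 winners pays (R - B(y)) / (k - 1), so the revenue is always R. Conditioning on a
  bidder's own value x, the requirement that the expected payment be z(x) becomes a linear first
  order equation for the integral of B, which is solved explicitly:
      C B F^(n-k) (1-F)^k = N,
      N = (1-F) (z - R C W) + D,   D(x) = int_0^x (z - R C W) dF,   W = int F^(n-k) (1-F)^(k-2) dF,
  with C = binomial(n-1, k-1) and R such that D, hence N, vanishes at both ends. What remains is
  0 <= B <= R. The derivative of N is a nonnegative weight times c (1-F) x - R C F, and by
  regularity the revenue curve x (1-F(x)) is concave as a function of F(x), so this bracket changes
  sign at most once, from plus to minus; hence N >= 0. The derivative of R C F^(n-k) (1-F)^k - N is
  the same weight times a bracket that is convex in F, nonnegative at 0 and nonpositive at the upper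
  end, which gives B <= R in the same way.
*)
theory Submission
  imports Defs
begin

section \<open>The payment of the lowest winner\<close>

lemma mvt_real_within:
  fixes g g' :: "real \<Rightarrow> real"
  assumes "a < b" "{a..b} \<subseteq> S"
    and "\<And>x. x \<in> {a..b} \<Longrightarrow> (g has_real_derivative g' x) (at x within S)"
  obtains \<xi> where "a < \<xi>" "\<xi> < b" "g b - g a = g' \<xi> * (b - a)"
proof -
  have "\<exists>\<xi>\<in>{a<..<b}. g b - g a = g' \<xi> * (b - a)"
  proof (rule mvt_simple[OF \<open>a < b\<close>])
    fix x assume "a \<le> x" "x \<le> b"
    then have "(g has_real_derivative g' x) (at x within {a..b})"
      using assms by (intro DERIV_subset[OF assms(3)]) auto
    then show "(g has_derivative (*) (g' x)) (at x within {a..b})"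
      by (simp add: has_field_derivative_def)
  qed
  then show ?thesis using that by auto
qed

text \<open>Once \<open>g\<close> is negative it stays negative, so \<open>N\<close> first increases
  and then decreases, and its minimum sits at an end. The mean value theorem is used to the left of
  \<open>x\<close> if \<open>0 \<le> g x\<close> and to the right otherwise.\<close>

lemma nonneg_of_single_crossing:
  fixes N w g :: "real \<Rightarrow> real"
  assumes deriv: "\<And>x. x \<in> {a..b} \<Longrightarrow> (N has_real_derivative w x * g x) (at x within {a..b})"
    and w: "\<And>x. x \<in> {a..b} \<Longrightarrow> 0 \<le> w x"
    and crossing: "\<And>s t. a \<le> s \<Longrightarrow> s < t \<Longrightarrow> t < b \<Longrightarrow> 0 \<le> g t \<Longrightarrow> 0 \<le> g s"
    and ends: "0 \<le> N a" "0 \<le> N b"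
    and x: "x \<in> {a..b}"
  shows "0 \<le> N x"
proof (cases "x = a \<or> x = b")
  case True
  then show ?thesis using ends by auto
next
  case False
  then have ax: "a < x" "x < b" using x by auto
  show ?thesis
  proof (cases "0 \<le> g x")
    case True
    obtain \<xi> where \<xi>: "a < \<xi>" "\<xi> < x" "N x - N a = w \<xi> * g \<xi> * (x - a)"
      by (rule mvt_real_within[of a x "{a..b}" N "\<lambda>x. w x * g x"]) (use ax deriv in auto)
    moreover have "0 \<le> g \<xi>" using crossing[of \<xi> x] \<xi> ax True by auto
    moreover have "0 \<le> w \<xi>" using w[of \<xi>] \<xi> ax by auto
    ultimately show ?thesis using ends ax by (smt (verit) mult_nonneg_nonneg)
  next
    case False
    obtain \<xi> where \<xi>: "x < \<xi>" "\<xi> < b" "N b - N x = w \<xi> * g \<xi> * (b - x)"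
      by (rule mvt_real_within[of x b "{a..b}" N "\<lambda>x. w x * g x"]) (use ax deriv in auto)
    moreover have "g \<xi> \<le> 0" using crossing[of x \<xi>] \<xi> ax False by force
    moreover have "0 \<le> w \<xi>" using w[of \<xi>] \<xi> ax by auto
    ultimately have "N b - N x \<le> 0"
      using ax by (simp add: mult_nonneg_nonpos mult_nonpos_nonneg)
    then show ?thesis using ends by linarith
  qed
qed

text \<open>The factor \<open>\<psi>\<close> is the slope of \<open>g\<close> relative to an
  antiderivative of \<open>f\<close>; since it decreases, \<open>g\<close> is strictly concave in
  that variable. A value at \<open>t\<close> exceeding neither neighbour would force a slope \<le> 0
  before \<open>t\<close> and one \<ge> 0 after it.\<close>

lemma slope_decreasing_imp_quasiconcave:
  fixes g \<psi> f :: "real \<Rightarrow> real"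
  assumes deriv: "\<And>x. x \<in> {a..b} \<Longrightarrow> (g has_real_derivative f x * \<psi> x) (at x within {a..b})"
    and f: "\<And>x. x \<in> {a..b} \<Longrightarrow> 0 < f x"
    and decr: "\<And>s t. s \<in> {a..b} \<Longrightarrow> t \<in> {a..b} \<Longrightarrow> s < t \<Longrightarrow> \<psi> t < \<psi> s"
    and st: "a \<le> s" "s < t" "t < u" "u \<le> b"
  shows "min (g s) (g u) < g t"
proof (rule ccontr)
  assume "\<not> ?thesis"
  then have le: "g t \<le> g s" "g t \<le> g u" by auto
  obtain \<xi> where \<xi>: "s < \<xi>" "\<xi> < t" "g t - g s = f \<xi> * \<psi> \<xi> * (t - s)"
    by (rule mvt_real_within[of s t "{a..b}" g "\<lambda>x. f x * \<psi> x"]) (use st deriv in auto)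
  obtain \<eta> where \<eta>: "t < \<eta>" "\<eta> < u" "g u - g t = f \<eta> * \<psi> \<eta> * (u - t)"
    by (rule mvt_real_within[of t u "{a..b}" g "\<lambda>x. f x * \<psi> x"]) (use st deriv in auto)
  have f\<xi>: "0 < f \<xi>" "0 < f \<eta>" using f \<xi> \<eta> st by auto
  have "\<psi> \<eta> < \<psi> \<xi>" using decr \<xi> \<eta> st by auto
  moreover have "\<psi> \<xi> \<le> 0"
    using \<xi> f\<xi> le st by (smt (verit) mult_pos_pos)
  moreover have "0 \<le> \<psi> \<eta>"
    using \<eta> f\<xi> le st by (smt (verit) mult_pos_neg mult_neg_pos)
  ultimately show False by linarith
qed

section \<open>The value distribution and the equation for the lowest winner's payment\<close>

locale regular_density =
  fixes vbar :: real and f :: "real \<Rightarrow> real"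
  assumes vbar_pos: "0 < vbar"
    and f_pos: "\<And>x. x \<in> {0..vbar} \<Longrightarrow> 0 < f x"
    and f_cont: "continuous_on {0..vbar} f"
    and f_density: "integral {0..vbar} f = 1"
    and reg: "regular vbar f"
begin

abbreviation F :: "real \<Rightarrow> real" where "F \<equiv> cdf_of f"

lemma F_deriv:
  assumes "x \<in> {0..vbar}"
  shows "(F has_real_derivative f x) (at x within {0..vbar})"
  using integral_has_real_derivative[OF f_cont assms] by (simp add: cdf_of_def[abs_def])

lemma F_0 [simp]: "F 0 = 0" and F_vbar [simp]: "F vbar = 1"
  by (simp_all add: cdf_of_def f_density)

lemma F_cont: "continuous_on {0..vbar} F"
  by (rule DERIV_continuous_on[OF F_deriv])

lemma F_strict_mono:
  assumes "0 \<le> x" "x < y" "y \<le> vbar"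
  shows "F x < F y"
proof -
  obtain \<xi> where "x < \<xi>" "\<xi> < y" "F y - F x = f \<xi> * (y - x)"
    by (rule mvt_real_within[of x y "{0..vbar}" F f]) (use assms F_deriv in auto)
  moreover then have "0 < f \<xi>" using f_pos assms by auto
  ultimately show ?thesis using assms by (smt (verit) mult_pos_pos)
qed

lemma F_bounds:
  assumes "x \<in> {0..vbar}" shows "0 \<le> F x" "F x \<le> 1"
  using F_strict_mono[of 0 x] F_strict_mono[of x vbar] assms
  by (cases "x = 0"; cases "x = vbar"; force)+

lemma F_bounds_strict:
  shows "0 < x \<Longrightarrow> x \<le> vbar \<Longrightarrow> 0 < F x" "0 \<le> x \<Longrightarrow> x < vbar \<Longrightarrow> F x < 1"
  using F_strict_mono[of 0 x] F_strict_mono[of x vbar] by auto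

lemma virtual_value_strict_mono:
  assumes "x \<in> {0..vbar}" "y \<in> {0..vbar}" "x < y"
  shows "virtual_value f x < virtual_value f y"
  using reg assms by (auto simp: regular_def strict_mono_on_def)

text \<open>Relative to \<open>F\<close>, the revenue curve has slope minus the virtual value, so
  regularity makes it strictly concave in \<open>F\<close>. Both bounds on the payment use
  regularity in this form.\<close>

lemma revenue_curve_deriv:
  assumes "x \<in> {0..vbar}"
  shows "((\<lambda>x. (1 - F x) * x) has_real_derivative - (f x * virtual_value f x)) (at x within {0..vbar})"
proof -
  have "f x \<noteq> 0" using f_pos assms by force
  then show ?thesis
    by (auto intro!: derivative_eq_intros F_deriv assms simp: virtual_value_def field_simps)
qed

text \<open>
  \<open>D / (1 - F)\<close> has to be an antiderivative of \<open>C * B * F ^ Suc r * (1 - F) ^ s * f\<close>. At the upper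
  end \<open>B\<close> is \<open>0\<close> by convention, and the equation follows there by continuity since \<open>B\<close> is bounded.
\<close>

lemma lowest_winner_payment_exists:
  fixes C c :: real and z :: "real \<Rightarrow> real" and r s :: nat
  assumes C: "0 < C" and c: "0 < c" and z_0: "z 0 = 0"
    and z_deriv: "\<And>x. x \<in> {0..vbar} \<Longrightarrow>
      (z has_real_derivative c * x * F x ^ r * (1 - F x) ^ Suc s * f x) (at x within {0..vbar})"
  obtains B R where "B \<in> borel_measurable borel" "\<And>y. 0 \<le> B y" "\<And>y. B y \<le> R"
    "\<And>x. x \<in> {0..vbar} \<Longrightarrow>
      set_integrable lborel {0..x} (\<lambda>y. (R - B y) * F y ^ Suc r * (1 - F y) ^ s * f y)"
    "\<And>x. x \<in> {0..vbar} \<Longrightarrow>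
      C * B x * F x ^ Suc r * (1 - F x) ^ Suc s +
      C * integral {0..x} (\<lambda>y. (R - B y) * F y ^ Suc r * (1 - F y) ^ s * f y) = z x"
proof -
  note cont = F_cont f_cont
  have z_cont: "continuous_on {0..vbar} z"
    by (rule DERIV_continuous_on[OF z_deriv])
  \<comment> \<open>With \<open>r = n - k - 1\<close> and \<open>s = k - 2\<close>, this is up to a
    constant the density of the (k-1)-th highest of the other n-1 values: the lowest winning value
    as seen by a bidder above it.\<close>
  define w where "w y = F y ^ Suc r * (1 - F y) ^ s * f y" for y
  define W where "W x = integral {0..x} w" for x
  have w_cont: "continuous_on {0..vbar} w"
    unfolding w_def by (intro continuous_intros cont)
  have W_deriv: "(W has_real_derivative w x) (at x within {0..vbar})" if "x \<in> {0..vbar}" for x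
    using integral_has_real_derivative[OF w_cont that] by (simp add: W_def[abs_def])
  have W_cont: "continuous_on {0..vbar} W"
    by (rule DERIV_continuous_on[OF W_deriv])
  have W_0: "W 0 = 0" by (simp add: W_def)
  have Wf_cont: "continuous_on {0..vbar} (\<lambda>x. W x * f x)"
    and zf_cont: "continuous_on {0..vbar} (\<lambda>x. z x * f x)"
    by (intro continuous_intros cont W_cont z_cont)+
  have z_nonneg: "0 \<le> z x" if x: "x \<in> {0..vbar}" for x
  proof (cases "x = 0")
    case False
    obtain \<xi> where \<xi>: "0 < \<xi>" "\<xi> < x"
        "z x - z 0 = c * \<xi> * F \<xi> ^ r * (1 - F \<xi>) ^ Suc s * f \<xi> * (x - 0)"
      by (rule mvt_real_within[of 0 x "{0..vbar}" z
            "\<lambda>x. c * x * F x ^ r * (1 - F x) ^ Suc s * f x"])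
        (use x False z_deriv in auto)
    have "0 \<le> c * \<xi> * F \<xi> ^ r * (1 - F \<xi>) ^ Suc s * f \<xi> * (x - 0)"
      using \<xi> x c F_bounds[of \<xi>] f_pos[of \<xi>]
      by (intro mult_nonneg_nonneg zero_le_power) auto
    then show ?thesis using \<xi> z_0 by linarith
  qed (simp add: z_0)
  have W_pos: "0 < W x" if x: "0 < x" "x \<le> vbar" for x
  proof -
    obtain \<xi> where \<xi>: "0 < \<xi>" "\<xi> < x" "W x - W 0 = w \<xi> * (x - 0)"
      by (rule mvt_real_within[of 0 x "{0..vbar}" W w]) (use x W_deriv in auto)
    have "0 < w \<xi>"
      unfolding w_def using \<xi> x F_bounds_strict[of \<xi>] f_pos[of \<xi>]
      by (intro mult_pos_pos zero_less_power) auto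
    then show ?thesis using \<xi> x W_0 by simp
  qed
  define I where "I = integral {0..vbar} (\<lambda>x. W x * f x)"
  have I_pos: "0 < I"
  proof -
    obtain \<xi> where \<xi>: "0 < \<xi>" "\<xi> < vbar"
        "integral {0..vbar} (\<lambda>x. W x * f x) - integral {0..0} (\<lambda>x. W x * f x) = W \<xi> * f \<xi> * (vbar - 0)"
      by (rule mvt_real_within[of 0 vbar "{0..vbar}" "\<lambda>x. integral {0..x} (\<lambda>x. W x * f x)"])
        (use vbar_pos integral_has_real_derivative[OF Wf_cont] in auto)
    then show ?thesis
      using W_pos[of \<xi>] f_pos[of \<xi>] vbar_pos by (simp add: I_def)
  qed
  \<comment> \<open>Chosen so that \<open>D vbar = 0\<close>. Otherwise \<open>N\<close> below would
    not vanish at \<open>vbar\<close>, and the quotient \<open>N / K\<close> would be unbounded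
    there.\<close>
  define R where "R = integral {0..vbar} (\<lambda>x. z x * f x) / (C * I)"
  have R_nonneg: "0 \<le> R"
    unfolding R_def using C I_pos z_nonneg f_pos
    by (intro divide_nonneg_pos integral_nonneg mult_pos_pos mult_nonneg_nonneg
        integrable_continuous_real zf_cont) (auto intro: less_imp_le)
  \<comment> \<open>Let Y be the integral of \<open>C * B * w\<close> from 0. The required equation
    then reads Y' (1-F) - Y f = d, that is, ((1-F) Y)' = d, with solution Y = D / (1-F).\<close>
  define d where "d x = (z x - R * C * W x) * f x" for x
  have d_cont: "continuous_on {0..vbar} d"
    unfolding d_def by (intro continuous_intros cont W_cont z_cont)
  define D where "D x = integral {0..x} d" for x
  have D_deriv: "(D has_real_derivative d x) (at x within {0..vbar})" if "x \<in> {0..vbar}" for x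
    using integral_has_real_derivative[OF d_cont that] by (simp add: D_def[abs_def])
  have D_cont: "continuous_on {0..vbar} D"
    by (rule DERIV_continuous_on[OF D_deriv])
  have D_0: "D 0 = 0" by (simp add: D_def)
  have D_vbar: "D vbar = 0"
  proof -
    have "D vbar = integral {0..vbar} (\<lambda>x. z x * f x - (R * C) * (W x * f x))"
      by (simp add: D_def d_def[abs_def] algebra_simps)
    also have "\<dots> = integral {0..vbar} (\<lambda>x. z x * f x) - (R * C) * I"
      unfolding I_def using integrable_continuous_real[OF zf_cont] integrable_continuous_real[OF Wf_cont]
      by (subst Henstock_Kurzweil_Integration.integral_diff)
        (auto intro!: integrable_on_mult_right)
    also have "\<dots> = 0" using C I_pos by (simp add: R_def)
    finally show ?thesis .
  qed
  \<comment> \<open>This is Y' (1-F)^2 / f for Y = D / (1-F), which has to equal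
    \<open>B * K\<close> with the \<open>K\<close> defined below. In its derivative the terms with
    \<open>z - R * C * W\<close> cancel, leaving \<open>\<rho> * g\<close>.\<close>
  define N where "N x = (1 - F x) * (z x - R * C * W x) + D x" for x
  define \<rho> where "\<rho> x = f x * F x ^ r * (1 - F x) ^ Suc s" for x
  have \<rho>_nonneg: "0 \<le> \<rho> x" if "x \<in> {0..vbar}" for x
    unfolding \<rho>_def using F_bounds[OF that] f_pos[OF that]
    by (intro mult_nonneg_nonneg zero_le_power) auto
  define g where "g x = c * ((1 - F x) * x) - R * C * F x" for x
  have N_deriv: "(N has_real_derivative \<rho> x * g x) (at x within {0..vbar})" if x: "x \<in> {0..vbar}" for x
    unfolding N_def
    by (rule derivative_eq_intros F_deriv z_deriv W_deriv D_deriv x refl)+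
      (simp add: \<rho>_def g_def d_def w_def algebra_simps)
  have N_cont: "continuous_on {0..vbar} N"
    by (rule DERIV_continuous_on[OF N_deriv])
  have N_0: "N 0 = 0" and N_vbar: "N vbar = 0"
    by (simp_all add: N_def z_0 W_0 D_0 D_vbar)
  have g_deriv: "(g has_real_derivative f x * (- c * virtual_value f x - R * C)) (at x within {0..vbar})"
    if x: "x \<in> {0..vbar}" for x
    unfolding g_def
    by (rule derivative_eq_intros F_deriv revenue_curve_deriv x refl)+ (simp add: algebra_simps)
  have N_nonneg: "0 \<le> N x" if x: "x \<in> {0..vbar}" for x
  proof (rule nonneg_of_single_crossing[OF N_deriv \<rho>_nonneg _ _ _ x])
    fix s t :: real assume st: "0 \<le> s" "s < t" "t < vbar" "0 \<le> g t"
    show "0 \<le> g s"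
    proof (cases "s = 0")
      case True then show ?thesis by (simp add: g_def)
    next
      case False
      \<comment> \<open>Since \<open>g 0 = 0\<close>, quasiconcavity carries
        \<open>0 \<le> g t\<close> back to every earlier point.\<close>
      have "min (g 0) (g t) < g s"
        by (rule slope_decreasing_imp_quasiconcave[OF g_deriv f_pos])
          (use st c False virtual_value_strict_mono in auto)
      then show ?thesis using st by (simp add: g_def)
    qed
  qed (simp_all add: N_0 N_vbar)
  \<comment> \<open>Equal to \<open>R * K - N\<close>, so that \<open>0 \<le> M\<close> gives
    \<open>B \<le> R\<close> after division by \<open>K\<close>.\<close>
  define M where "M x = R * C * F x ^ Suc r * (1 - F x) ^ (s + 2) - N x" for x
  define h where "h x = R * C * ((real r + 1) * (1 - F x) - (real s + 1) * F x) - c * ((1 - F x) * x)" for x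
  have M_deriv: "(M has_real_derivative \<rho> x * h x) (at x within {0..vbar})" if x: "x \<in> {0..vbar}" for x
    unfolding M_def
    by (rule derivative_eq_intros F_deriv N_deriv x refl)+
      (simp add: \<rho>_def g_def h_def algebra_simps)
  have h_deriv: "((\<lambda>x. - h x) has_real_derivative
      f x * (R * C * (real r + real s + 2) - c * virtual_value f x)) (at x within {0..vbar})"
    if x: "x \<in> {0..vbar}" for x
    unfolding h_def
    by (rule derivative_eq_intros F_deriv revenue_curve_deriv x refl)+ (simp add: algebra_simps)
  have M_nonneg: "0 \<le> M x" if x: "x \<in> {0..vbar}" for x
  proof (rule nonneg_of_single_crossing[OF M_deriv \<rho>_nonneg _ _ _ x])
    fix a t :: real assume st: "0 \<le> a" "a < t" "t < vbar" "0 \<le> h t"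
    \<comment> \<open>As \<open>h\<close> is convex in \<open>F\<close>, quasiconcavity is applied
      to \<open>- h\<close>, with \<open>vbar\<close> as third point. There \<open>h\<close> is at
      most 0, so with \<open>0 \<le> h t\<close> the strict inequality can only come from
      \<open>a\<close>.\<close>
    have "min (- h a) (- h vbar) < - h t"
      by (rule slope_decreasing_imp_quasiconcave[OF h_deriv f_pos])
        (use st c virtual_value_strict_mono in auto)
    moreover have "h vbar \<le> 0"
      using R_nonneg C by (simp add: h_def mult_nonneg_nonpos)
    ultimately show "0 \<le> h a" using st by linarith
  qed (simp_all add: M_def N_0 N_vbar)
  define K where "K x = C * F x ^ Suc r * (1 - F x) ^ (s + 2)" for x
  have K_cont: "continuous_on {0..vbar} K"
    unfolding K_def by (intro continuous_intros cont)
  have K_pos: "0 < K x" if "0 < x" "x < vbar" for x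
    unfolding K_def using F_bounds_strict[of x] that C
    by (intro mult_pos_pos zero_less_power) auto
  \<comment> \<open>\<open>K\<close> vanishes at both ends. The default 0 keeps
    \<open>0 \<le> B \<le> R\<close> valid on all reals and \<open>B * K = N\<close> valid at the
    ends, where \<open>N\<close> vanishes too.\<close>
  define B where "B x = (if x \<in> {0<..<vbar} then N x / K x else 0)" for x
  have B_nonneg: "0 \<le> B x" and B_le: "B x \<le> R" for x
  proof -
    have "0 \<le> N x / K x \<and> N x / K x \<le> R" if x: "x \<in> {0<..<vbar}"
      using N_nonneg[of x] M_nonneg[of x] K_pos[of x] x
      by (auto simp: M_def K_def divide_simps algebra_simps)
    then show "0 \<le> B x" "B x \<le> R" using R_nonneg by (auto simp: B_def)
  qed
  have B_meas: "B \<in> borel_measurable borel"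
  proof -
    have "continuous_on {0<..<vbar} (\<lambda>x. N x / K x)"
      by (intro continuous_intros continuous_on_subset[OF N_cont] continuous_on_subset[OF K_cont])
        (use K_pos in force)+
    then have "(\<lambda>x. indicator {0<..<vbar} x *\<^sub>R (N x / K x)) \<in> borel_measurable borel"
      by (intro borel_measurable_continuous_on_indicator) auto
    also have "(\<lambda>x. indicator {0<..<vbar} x *\<^sub>R (N x / K x)) = B"
      by (auto simp: B_def fun_eq_iff)
    finally show ?thesis .
  qed
  have BK: "B x * K x = N x" if "x \<in> {0..vbar}" for x
    using that K_pos[of x] N_0 N_vbar by (cases "x = 0 \<or> x = vbar") (auto simp: B_def)
  have integrable: "set_integrable lborel {0..x} (\<lambda>y. (R - B y) * F y ^ Suc r * (1 - F y) ^ s * f y)"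
    if x: "x \<in> {0..vbar}" for x
  proof -
    have "set_integrable lborel {0..x} (\<lambda>y. R * w y)"
      by (intro borel_integrable_atLeastAtMost' continuous_intros continuous_on_subset[OF w_cont])
        (use x in auto)
    moreover have "(\<lambda>y. indicator {0..x} y *\<^sub>R w y) \<in> borel_measurable borel"
      by (intro borel_measurable_continuous_on_indicator continuous_on_subset[OF w_cont])
        (use x in auto)
    then have "(\<lambda>y. (R - B y) * (indicator {0..x} y *\<^sub>R w y)) \<in> borel_measurable borel"
      using B_meas by measurable
    then have "set_borel_measurable lborel {0..x} (\<lambda>y. (R - B y) * w y)"
      by (simp add: set_borel_measurable_def mult_ac)
    moreover have "AE y in lborel. y \<in> {0..x} \<longrightarrow> norm ((R - B y) * w y) \<le> norm (R * w y)"
      using B_nonneg B_le R_nonneg by (auto simp: abs_mult intro!: mult_right_mono)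
    ultimately have "set_integrable lborel {0..x} (\<lambda>y. (R - B y) * w y)"
      by (rule set_integrable_bound)
    then show ?thesis by (simp add: w_def mult_ac)
  qed
  define U where "U x = integral {0..x} (\<lambda>y. (R - B y) * F y ^ Suc r * (1 - F y) ^ s * f y)" for x
  have U_cont: "continuous_on {0..vbar} U"
    unfolding U_def using integrable[of vbar] vbar_pos
    by (intro indefinite_integral_continuous_1 set_borel_integral_eq_integral) auto
  have interior: "C * B x * F x ^ Suc r * (1 - F x) ^ Suc s + C * U x = z x"
    if x: "0 \<le> x" "x < vbar" for x
  proof -
    have lt1: "F y < 1" if "y \<in> {0..x}" for y
      using F_bounds_strict[of y] that x by auto
    \<comment> \<open>The derivative of \<open>D / (1 - F)\<close> is f N / (1-F)^2 by the
      definition of \<open>N\<close>, and this is \<open>C * B * w\<close> because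
      \<open>B * K = N\<close>.\<close>
    have T: "((\<lambda>y. R * C * W y - D y / (1 - F y)) has_real_derivative C * ((R - B y) * w y)) (at y within {0..x})"
      if y: "y \<in> {0..x}" for y
    proof -
      have yv: "y \<in> {0..vbar}" using y x by auto
      have "((\<lambda>y. R * C * W y - D y / (1 - F y)) has_real_derivative 
        R * C * w y - (d y * (1 - F y) + D y * f y) / (1 - F y)\<^sup>2) (at y within {0..vbar})"
        using lt1[OF y]
        by (auto intro!: derivative_eq_intros F_deriv W_deriv D_deriv yv simp: power2_eq_square)
      also have "R * C * w y - (d y * (1 - F y) + D y * f y) / (1 - F y)\<^sup>2 =
          R * C * w y - f y * (B y * K y) / (1 - F y)\<^sup>2"
        by (simp add: BK[OF yv] N_def d_def algebra_simps)
      also have "\<dots> = C * ((R - B y) * w y)"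
      proof -
        have "f y * (B y * K y) = C * (B y * w y) * (1 - F y)\<^sup>2"
          by (simp add: K_def w_def power2_eq_square mult_ac)
        then show ?thesis using lt1[OF y] by (simp only:) (simp add: algebra_simps)
      qed
      finally show ?thesis by (rule DERIV_subset) (use x in auto)
    qed
    have "((\<lambda>y. C * ((R - B y) * w y)) has_integral
        (R * C * W x - D x / (1 - F x)) - (R * C * W 0 - D 0 / (1 - F 0))) {0..x}"
      using x T by (intro fundamental_theorem_of_calculus)
        (auto simp: has_real_derivative_iff_has_vector_derivative[symmetric])
    then have "C * U x = R * C * W x - D x / (1 - F x)"
      using C by (simp add: W_0 D_0 U_def w_def mult_ac integral_unique flip: integral_mult_right)
    moreover have "C * B x * F x ^ Suc r * (1 - F x) ^ Suc s = B x * K x / (1 - F x)"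
    proof -
      have "B x * K x = C * B x * F x ^ Suc r * (1 - F x) ^ Suc s * (1 - F x)"
        by (simp add: K_def mult_ac)
      then show ?thesis using lt1[of x] x by (simp only:) simp
    qed
    moreover have "\<dots> = z x - R * C * W x + D x / (1 - F x)"
      using BK[of x] lt1[of x] x by (simp add: N_def field_simps)
    ultimately show ?thesis by simp
  qed
  have limit: "z vbar - C * U vbar = 0"
  proof -
    have cl: "closure {0..<vbar} = {0..vbar}" using vbar_pos by simp
    \<comment> \<open>A squeeze: the term with \<open>B\<close> lies between 0 and a multiple of
      \<open>1 - F x\<close>, which vanishes at \<open>vbar\<close>. The two resulting weak
      inequalities involve only continuous functions and so extend to the closure.\<close>
    have "0 \<le> C * B x * F x ^ Suc r * (1 - F x) ^ Suc s \<and>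
        C * B x * F x ^ Suc r * (1 - F x) ^ Suc s \<le> C * R * (1 - F x)"
      if x: "x \<in> {0..<vbar}" for x
    proof -
      have b: "0 \<le> F x" "F x \<le> 1" using F_bounds[of x] x by auto
      have "F x ^ Suc r * (1 - F x) ^ Suc s \<le> 1 * (1 - F x)"
        using b by (intro mult_mono power_le_one power_Suc_le_self) auto
      moreover have "0 \<le> F x ^ Suc r * (1 - F x) ^ Suc s"
        using b by (intro mult_nonneg_nonneg zero_le_power) auto
      moreover have "0 \<le> C * B x * p \<and> C * B x * p \<le> C * R * q" if "0 \<le> p" "p \<le> q" for p q
        using C B_nonneg[of x] B_le[of x] R_nonneg that by (auto intro!: mult_mono)
      ultimately have "0 \<le> C * B x * (F x ^ Suc r * (1 - F x) ^ Suc s) \<and>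
          C * B x * (F x ^ Suc r * (1 - F x) ^ Suc s) \<le> C * R * (1 * (1 - F x))"
        by blast
      then show ?thesis by (simp add: mult_ac)
    qed
    then have "- (z x - C * U x) \<le> 0" "z x - C * U x - C * R * (1 - F x) \<le> 0"
      if "x \<in> {0..<vbar}" for x
      using interior[of x] that by force+
    moreover have "continuous_on (closure {0..<vbar}) (\<lambda>x. - (z x - C * U x))"
      "continuous_on (closure {0..<vbar}) (\<lambda>x. z x - C * U x - C * R * (1 - F x))"
      unfolding cl by (intro continuous_intros z_cont U_cont F_cont)+
    ultimately have "- (z vbar - C * U vbar) \<le> 0" "z vbar - C * U vbar - C * R * (1 - F vbar) \<le> 0"
      using continuous_le_on_closure[of "{0..<vbar}" "\<lambda>x. - (z x - C * U x)" vbar 0]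
        continuous_le_on_closure[of "{0..<vbar}" "\<lambda>x. z x - C * U x - C * R * (1 - F x)" vbar 0]
        cl vbar_pos by auto
    then show ?thesis by simp
  qed
  have "C * B x * F x ^ Suc r * (1 - F x) ^ Suc s + C * U x = z x" if "x \<in> {0..vbar}" for x
    using interior[of x] limit that by (cases "x = vbar") auto
  then show ?thesis
    using that[OF B_meas B_nonneg B_le integrable] by (simp add: U_def)
qed

end

section \<open>Ranks and their distribution\<close>

text \<open>Ties go to the smaller index, as in \<open>efficient_alloc\<close>. This is a strict
  total order on bidders for every profile, so the statements about ranks need no exceptional null
  set.\<close>

definition beats :: "(nat \<Rightarrow> real) \<Rightarrow> nat \<Rightarrow> nat \<Rightarrow> bool" where
  "beats v j i \<longleftrightarrow> v i < v j \<or> (v j = v i \<and> j < i)"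

text \<open>Ranks start at 0: the winners have ranks below \<open>k\<close>, and the lowest winner
  has rank \<open>k - 1\<close>.\<close>

definition rank_of :: "nat \<Rightarrow> (nat \<Rightarrow> real) \<Rightarrow> nat \<Rightarrow> nat" where
  "rank_of n v i = card {j\<in>{..<n}. beats v j i}"

lemma efficient_alloc_rank_of: "efficient_alloc n k v i = of_bool (i < n \<and> rank_of n v i < k)"
  by (simp add: efficient_alloc_def rank_of_def beats_def)

text \<open>By transitivity whoever beats \<open>i\<close> also beats \<open>j\<close>, and
  \<open>i\<close> itself beats \<open>j\<close> but not itself.\<close>

lemma rank_of_less_if_beats:
  assumes "i < n" "beats v i j"
  shows "rank_of n v i < rank_of n v j"
  unfolding rank_of_def
proof (rule psubset_card_mono)
  show "{l \<in> {..<n}. beats v l i} \<subset> {l \<in> {..<n}. beats v l j}"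
    using assms by (auto simp: beats_def)
qed simp

lemma beats_total: "i \<noteq> j \<Longrightarrow> beats v i j \<or> beats v j i"
  by (auto simp: beats_def)

text \<open>Totality of \<open>beats\<close> gives injectivity, and an injective self-map of a
  finite set is onto. Hence there is exactly one bidder of rank \<open>k - 1\<close> whenever
  \<open>0 < k \<le> n\<close>.\<close>

lemma bij_betw_rank_of: "bij_betw (rank_of n v) {..<n} {..<n}"
proof -
  have inj: "inj_on (rank_of n v) {..<n}"
  proof (rule inj_onI)
    fix i j assume "i \<in> {..<n}" "j \<in> {..<n}" "rank_of n v i = rank_of n v j"
    then show "i = j"
      using beats_total[of i j v] rank_of_less_if_beats[of i n v j] rank_of_less_if_beats[of j n v i] by auto
  qed
  have "rank_of n v i < n" if "i < n" for i
  proof -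
    have "rank_of n v i \<le> card ({..<n} - {i})"
      unfolding rank_of_def by (rule card_mono) (auto simp: beats_def)
    then show ?thesis using that by simp
  qed
  then have "rank_of n v ` {..<n} \<subseteq> {..<n}" by auto
  then show ?thesis
    using endo_inj_surj[OF _ _ inj] inj by (simp add: bij_betw_def)
qed

text \<open>Factors the event that \<open>S\<close> is exactly the set of hits in \<open>J\<close>
  over the coordinates, so that the product measure can be integrated factor by factor.\<close>

lemma prod_of_bool_eq_count:
  assumes "finite I" "S \<subseteq> J" "J \<subseteq> I"
  shows "(\<Prod>l\<in>I. if l \<in> J then of_bool (b l \<longleftrightarrow> l \<in> S) else 1) = (of_bool (S = {l\<in>J. b l}) :: real)"
proof -
  have "(\<Prod>l\<in>I. if l \<in> J then of_bool (b l \<longleftrightarrow> l \<in> S) else 1) = (\<Prod>l\<in>I. of_bool (l \<in> J \<longrightarrow> (b l \<longleftrightarrow> l \<in> S)) :: real)"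
    by (rule prod.cong) auto
  also have "\<dots> = of_bool (\<forall>l\<in>I. l \<in> J \<longrightarrow> (b l \<longleftrightarrow> l \<in> S))"
    using assms(1) by (induction I rule: finite_induct) auto
  also have "(\<forall>l\<in>I. l \<in> J \<longrightarrow> (b l \<longleftrightarrow> l \<in> S)) \<longleftrightarrow> S = {l\<in>J. b l}"
    using assms by auto
  finally show ?thesis .
qed

section \<open>Counting and conditioning in a product of copies of one probability space\<close>

context prob_space
begin

lemma product_sigma_finite_const: "product_sigma_finite (\<lambda>_. M)"
  by standard

text \<open>The number of hits among independent events of equal probability is binomial. The event
  is split according to the set \<open>S\<close> of hits; each of the \<open>card J choose m\<close>
  sets contributes the same product.\<close>

lemma integral_PiM_count:
  fixes I J :: "'i set"
  assumes "finite I" "J \<subseteq> I"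
    and Q: "\<And>l. l \<in> J \<Longrightarrow> Q l \<in> events" "\<And>l. l \<in> J \<Longrightarrow> prob (Q l) = q"
  shows "(\<integral>v. of_bool (card {l\<in>J. v l \<in> Q l} = m) \<partial>PiM I (\<lambda>_. M)) =
    real (card J choose m) * q ^ m * (1 - q) ^ (card J - m)"
proof -
  interpret product_sigma_finite "\<lambda>_::'i. M" by (rule product_sigma_finite_const)
  have finJ: "finite J" using assms(1,2) finite_subset by blast
  let ?\<S> = "{S. S \<subseteq> J \<and> card S = m}"
  have fin: "finite ?\<S>" using finJ by auto
  define g :: "'i set \<Rightarrow> 'i \<Rightarrow> 'a \<Rightarrow> real" where
    "g S l y = (if l \<in> J then of_bool (y \<in> Q l \<longleftrightarrow> l \<in> S) else 1)" for S l y
  have g_eq: "g S l y = (if l \<in> J then if l \<in> S then indicator (Q l) y else 1 - indicator (Q l) y else 1)" for S l y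
    by (auto simp: g_def indicator_def)
  have g_int: "integrable M (g S l)" for S l
    unfolding g_eq using Q(1)[of l]
    by (cases "l \<in> J"; cases "l \<in> S") (simp_all add: emeasure_eq_measure)
  have g_val: "integral\<^sup>L M (g S l) = (if l \<in> J then if l \<in> S then q else 1 - q else 1)" for S l
    unfolding g_eq using Q[of l]
    by (cases "l \<in> J"; cases "l \<in> S") (simp_all add: emeasure_eq_measure prob_space)
  have "(\<integral>v. of_bool (card {l\<in>J. v l \<in> Q l} = m) \<partial>PiM I (\<lambda>_. M)) =
      (\<integral>v. (\<Sum>S\<in>?\<S>. \<Prod>l\<in>I. g S l (v l)) \<partial>PiM I (\<lambda>_. M))"
  proof (rule Bochner_Integration.integral_cong[OF refl])
    fix v :: "'i \<Rightarrow> 'a"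
    have "(\<Sum>S\<in>?\<S>. \<Prod>l\<in>I. g S l (v l)) = (\<Sum>S\<in>?\<S>. of_bool (S = {l\<in>J. v l \<in> Q l}))"
      unfolding g_def
      by (intro sum.cong refl prod_of_bool_eq_count) (use assms in auto)
    also have "\<dots> = of_bool ({l\<in>J. v l \<in> Q l} \<in> ?\<S>)"
      using fin by (simp add: of_bool_def)
    finally show "of_bool (card {l\<in>J. v l \<in> Q l} = m) = (\<Sum>S\<in>?\<S>. \<Prod>l\<in>I. g S l (v l))"
      by simp
  qed
  also have "\<dots> = (\<Sum>S\<in>?\<S>. \<integral>v. (\<Prod>l\<in>I. g S l (v l)) \<partial>PiM I (\<lambda>_. M))"
    by (intro Bochner_Integration.integral_sum product_integrable_prod \<open>finite I\<close> g_int)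
  also have "\<dots> = (\<Sum>S\<in>?\<S>. \<Prod>l\<in>I. integral\<^sup>L M (g S l))"
    by (intro sum.cong refl product_integral_prod \<open>finite I\<close> g_int)
  also have "\<dots> = (\<Sum>S\<in>?\<S>. q ^ m * (1 - q) ^ (card J - m))"
  proof (rule sum.cong[OF refl])
    fix S assume S: "S \<in> ?\<S>"
    have "(\<Prod>l\<in>I. integral\<^sup>L M (g S l)) = (\<Prod>l\<in>J. if l \<in> S then q else 1 - q)"
      unfolding g_val using assms by (intro prod.mono_neutral_cong_right) auto
    also have "\<dots> = (\<Prod>l\<in>J \<inter> S. q) * (\<Prod>l\<in>J - S. 1 - q)"
      using finJ by (subst prod.If_cases) (auto simp: Diff_eq)
    also have "J \<inter> S = S" using S by auto
    also have "card (J - S) = card J - m"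
      using S finJ by (auto simp: card_Diff_subset finite_subset)
    then have "(\<Prod>l\<in>S. q) * (\<Prod>l\<in>J - S. 1 - q) = q ^ m * (1 - q) ^ (card J - m)"
      using S by simp
    finally show "(\<Prod>l\<in>I. integral\<^sup>L M (g S l)) = q ^ m * (1 - q) ^ (card J - m)" .
  qed
  also have "\<dots> = real (card J choose m) * q ^ m * (1 - q) ^ (card J - m)"
    using n_subsets[OF finJ, of m] by simp
  finally show ?thesis .
qed

text \<open>Fubini along the map that writes one coordinate into a profile. It serves to condition
  on the value of the lowest winner.\<close>

lemma integral_PiM_insert:
  fixes g :: "('i \<Rightarrow> 'a) \<Rightarrow> real"
  assumes g: "integrable (PiM (insert j I) (\<lambda>_. M)) g"
  shows "integrable M (\<lambda>y. \<integral>v. g (v(j := y)) \<partial>PiM I (\<lambda>_. M))"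
    and "integral\<^sup>L (PiM (insert j I) (\<lambda>_. M)) g = (\<integral>y. (\<integral>v. g (v(j := y)) \<partial>PiM I (\<lambda>_. M)) \<partial>M)"
proof -
  let ?P = "PiM I (\<lambda>_. M)" and ?Q = "PiM (insert j I) (\<lambda>_. M)"
  have eq: "distr (M \<Otimes>\<^sub>M ?P) ?Q (\<lambda>(x, X). X(j := x)) = ?Q"
    by (rule distr_pair_PiM_eq_PiM) (rule prob_space_axioms)+
  interpret Q: prob_space ?P by (intro prob_space_PiM prob_space_axioms)
  interpret pair_prob_space M ?P ..
  have meas: "(\<lambda>(x, X). X(j := x)) \<in> M \<Otimes>\<^sub>M ?P \<rightarrow>\<^sub>M ?Q"
    by measurable
  have "integrable (distr (M \<Otimes>\<^sub>M ?P) ?Q (\<lambda>(x, X). X(j := x))) g"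
    by (simp add: eq g)
  then have int: "integrable (M \<Otimes>\<^sub>M ?P) (\<lambda>p. g ((\<lambda>(x, X). X(j := x)) p))"
    by (rule integrable_distr[OF meas])
  show "integrable M (\<lambda>y. \<integral>v. g (v(j := y)) \<partial>?P)"
    using integrable_fst'[OF int] by simp
  have "integral\<^sup>L ?Q g = integral\<^sup>L (distr (M \<Otimes>\<^sub>M ?P) ?Q (\<lambda>(x, X). X(j := x))) g"
    by (simp add: eq)
  also have "\<dots> = (\<integral>p. g ((\<lambda>(x, X). X(j := x)) p) \<partial>(M \<Otimes>\<^sub>M ?P))"
    using g by (intro integral_distr meas) auto
  also have "\<dots> = (\<integral>y. (\<integral>v. g ((\<lambda>(x, X). X(j := x)) (y, v)) \<partial>?P) \<partial>M)"
    by (rule integral_fst'[OF int, symmetric])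
  finally show "integral\<^sup>L ?Q g = (\<integral>y. (\<integral>v. g (v(j := y)) \<partial>?P) \<partial>M)" by simp
qed

end

section \<open>The value distribution as a probability measure\<close>

context regular_density
begin

abbreviation V :: "real measure" where "V \<equiv> val_measure vbar f"

lemma density_measurable: "(\<lambda>x. f x * indicator {0..vbar} x) \<in> borel_measurable borel"
  using borel_measurable_continuous_on_indicator[OF _ f_cont] by (simp add: mult.commute)

lemma sets_V [measurable_cong, simp]: "sets V = sets borel"
  and space_V [simp]: "space V = UNIV"
  by (simp_all add: val_measure_def)

lemma AE_V_support: "AE y in V. y \<in> {0..vbar}"
  unfolding val_measure_def using density_measurable
  by (subst AE_density) (auto simp: indicator_def)

lemma AE_V_neq: "AE y in V. y \<noteq> x"
  unfolding val_measure_def using density_measurable AE_lborel_singleton[of x]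
  by (subst AE_density) auto

text \<open>Links expectations under \<open>V\<close> to the gauge integrals in which the payment
  equation is stated.\<close>

lemma integral_V:
  fixes g :: "real \<Rightarrow> real"
  assumes x: "x \<in> {0..vbar}" and g: "set_integrable lborel {0..x} (\<lambda>y. g y * f y)"
  shows "integrable V (\<lambda>y. indicator {0..x} y * g y)"
    and "(\<integral>y. indicator {0..x} y * g y \<partial>V) = integral {0..x} (\<lambda>y. g y * f y)"
proof -
  let ?d = "\<lambda>x. f x * indicator {0..vbar} x" and ?g = "\<lambda>y. indicator {0..x} y * g y"
  have eq: "(\<lambda>y. ?d y *\<^sub>R ?g y) = (\<lambda>y. indicator {0..x} y *\<^sub>R (g y * f y))"
    using x by (auto simp: indicator_def fun_eq_iff)
  have "(\<lambda>y. indicator {0..x} y *\<^sub>R (g y * f y)) \<in> borel_measurable borel"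
    using g by (auto simp: set_integrable_def)
  \<comment> \<open>Only \<open>g * f\<close> is known to be measurable; dividing by the density,
    which is positive on the support, recovers \<open>g\<close> on \<open>{0..x}\<close>.\<close>
  then have "(\<lambda>y. (indicator {0..x} y *\<^sub>R (g y * f y)) / ?d y) \<in> borel_measurable borel"
    using density_measurable by measurable
  also have "(\<lambda>y. (indicator {0..x} y *\<^sub>R (g y * f y)) / ?d y) = ?g"
    using x f_pos by (force simp: indicator_def fun_eq_iff)
  finally have g_meas: "?g \<in> borel_measurable lborel" by simp
  have d_meas: "?d \<in> borel_measurable lborel" using density_measurable by simp
  have nn: "AE y in lborel. 0 \<le> ?d y"
    using f_pos by (auto simp: indicator_def intro: less_imp_le)
  show "integrable V ?g"
    unfolding val_measure_def integrable_density[OF g_meas d_meas nn] eq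
    using g by (simp only: set_integrable_def)
  show "integral\<^sup>L V ?g = integral {0..x} (\<lambda>y. g y * f y)"
    unfolding val_measure_def set_borel_integral_eq_integral(2)[OF g, symmetric]
    by (simp only: integral_density[OF g_meas d_meas nn] eq set_lebesgue_integral_def)
qed

lemma f_set_integrable: "x \<in> {0..vbar} \<Longrightarrow> set_integrable lborel {0..x} f"
  by (intro borel_integrable_atLeastAtMost' continuous_on_subset[OF f_cont]) auto

lemma emeasure_V_Icc:
  assumes "x \<in> {0..vbar}"
  shows "emeasure V {0..x} = ennreal (F x)"
proof -
  have "integrable V (indicator {0..x} :: real \<Rightarrow> real)"
    "integral\<^sup>L V (indicator {0..x} :: real \<Rightarrow> real) = F x"
    using integral_V[OF assms, of "\<lambda>_. 1"] f_set_integrable[OF assms] by (simp_all add: cdf_of_def)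
  then show ?thesis
    by (simp add: integrable_indicator_iff emeasure_eq_ennreal_measure)
qed

sublocale V: prob_space V
proof
  have "emeasure V (space V) = emeasure V {0..vbar}"
    by (rule emeasure_eq_AE) (use AE_V_support in auto)
  then show "emeasure V (space V) = 1"
    using emeasure_V_Icc[of vbar] vbar_pos by simp
qed

text \<open>A tie with \<open>x\<close> has probability zero, so the tie-breaking flag
  \<open>b\<close> does not change the value.\<close>

lemma prob_V_above:
  assumes x: "x \<in> {0..vbar}"
  shows "V.prob {y. x < y \<or> (y = x \<and> b)} = 1 - F x"
proof -
  have "V.prob {y. x < y \<or> (y = x \<and> b)} = V.prob (space V - {0..x})"
  proof (rule measure_eq_AE)
    show "AE y in V. y \<in> {y. x < y \<or> (y = x \<and> b)} \<longleftrightarrow> y \<in> space V - {0..x}"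
      using AE_V_support AE_V_neq[of x] by eventually_elim auto
    have "{y. x < y \<or> (y = x \<and> b)} = (if b then {x..} else {x<..})" by auto
    then show "{y. x < y \<or> (y = x \<and> b)} \<in> sets V" by simp
  qed simp
  also have "\<dots> = 1 - V.prob {0..x}"
    by (rule V.prob_compl) simp
  also have "V.prob {0..x} = F x"
    using emeasure_V_Icc[OF x] F_bounds[OF x] by (simp add: measure_def)
  finally show ?thesis .
qed

end

section \<open>Interim expectations\<close>

text \<open>Differentiating the terms gives a telescoping sum of which only the last piece survives.
  With p = F x and N = n - 1 this is the slope of the winning probability.\<close>

lemma binomial_tail_deriv:
  assumes "k < N"
  shows "((\<lambda>p. \<Sum>m<Suc k. real (N choose m) * (1 - p) ^ m * p ^ (N - m)) has_real_derivative
    real (N choose k) * real (N - k) * (1 - p) ^ k * p ^ (N - k - 1)) (at p)"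
  using assms
proof (induction k)
  case 0
  then show ?case using DERIV_pow[of N p UNIV] by simp
next
  case (Suc k)
  define t where "t = N - Suc (Suc k)"
  have N: "N = Suc (Suc k) + t" using Suc.prems by (simp add: t_def)
  \<comment> \<open>The absorption identity makes the negative part of the new term's derivative
    cancel the whole derivative from the induction hypothesis.\<close>
  have absorb: "real (N choose Suc k) * real (Suc k) = real (N choose k) * real (N - k)"
    using binomial_absorption[of k N] binomial_absorb_comp[of N k]
    by (metis mult.commute of_nat_mult)
  have power: "((\<lambda>p::real. (1 - p) ^ Suc k * p ^ Suc t) has_real_derivative
      real (Suc t) * ((1 - p) ^ Suc k * p ^ t) - real (Suc k) * ((1 - p) ^ k * p ^ Suc t)) (at p)"
  proof -
    have "((\<lambda>p::real. (1 - p) ^ Suc k) has_real_derivative real (Suc k) * (1 - p) ^ k * (-1)) (at p)"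
    proof -
      have "((\<lambda>p::real. 1 - p) has_real_derivative - 1) (at p)"
        by (auto intro!: derivative_eq_intros)
      from DERIV_power[OF this, of "Suc k"] show ?thesis by (simp del: power_Suc)
    qed
    from DERIV_mult[OF this DERIV_pow[of "Suc t" p]] show ?thesis
      by (simp add: mult_ac)
  qed
  have "((\<lambda>p. (\<Sum>m<Suc k. real (N choose m) * (1 - p) ^ m * p ^ (N - m)) +
        real (N choose Suc k) * ((1 - p) ^ Suc k * p ^ Suc t)) has_real_derivative
      real (N choose k) * real (N - k) * (1 - p) ^ k * p ^ (N - k - 1) +
      real (N choose Suc k) *
        (real (Suc t) * ((1 - p) ^ Suc k * p ^ t) - real (Suc k) * ((1 - p) ^ k * p ^ Suc t))) (at p)"
    using Suc by (intro DERIV_add DERIV_cmult power) auto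
  also have "real (N choose k) * real (N - k) * (1 - p) ^ k * p ^ (N - k - 1) +
      real (N choose Suc k) *
        (real (Suc t) * ((1 - p) ^ Suc k * p ^ t) - real (Suc k) * ((1 - p) ^ k * p ^ Suc t)) =
      real (N choose Suc k) * real (Suc t) * ((1 - p) ^ Suc k * p ^ t)"
    unfolding absorb[symmetric] using N by (simp add: right_diff_distrib mult_ac)
  finally show ?case using N by (simp add: mult_ac)
qed

text \<open>The lowest winner pays \<open>B\<close> of the own value; every bidder beating the
  lowest winner pays \<open>A\<close> of the lowest winner's value. At most one term of the sum is
  nonzero, and the sum form lets expectations be taken opponent by opponent.\<close>

definition payment :: "nat \<Rightarrow> nat \<Rightarrow> (real \<Rightarrow> real) \<Rightarrow> (real \<Rightarrow> real) \<Rightarrow> (nat \<Rightarrow> real) \<Rightarrow> nat \<Rightarrow> real" where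
  "payment n k A B v i = of_bool (rank_of n v i = k - 1) * B (v i) +
     (\<Sum>j<n. of_bool (beats v i j \<and> rank_of n v j = k - 1) * A (v j))"

lemma payment_nonneg: "(\<And>y. 0 \<le> A y) \<Longrightarrow> (\<And>y. 0 \<le> B y) \<Longrightarrow> 0 \<le> payment n k A B v i"
  unfolding payment_def by (intro add_nonneg_nonneg sum_nonneg mult_nonneg_nonneg) auto

text \<open>A bidder of rank at least \<open>k\<close> beats only bidders of still higher rank,
  hence nobody of rank \<open>k - 1\<close>.\<close>

lemma payment_loser:
  assumes "i < n" "0 < k" "efficient_alloc n k v i = 0"
  shows "payment n k A B v i = 0"
proof -
  have "k \<le> rank_of n v i" using assms by (simp add: efficient_alloc_rank_of)
  then have not_beats: "\<not> (beats v i j \<and> rank_of n v j = k - 1)" for j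
    using rank_of_less_if_beats[OF assms(1), of v j] by auto
  have "rank_of n v i \<noteq> k - 1" using \<open>k \<le> rank_of n v i\<close> assms by auto
  moreover have "(\<Sum>j<n. of_bool (beats v i j \<and> rank_of n v j = k - 1) * A (v j)) = 0"
    by (rule sum.neutral) (simp only: not_beats, simp)
  ultimately show ?thesis by (simp add: payment_def)
qed

text \<open>The \<open>j\<close> is the unique bidder of rank \<open>k - 1\<close>; by the
  definition of rank, exactly \<open>k - 1\<close> bidders beat \<open>j\<close>.\<close>

lemma sum_payment:
  assumes "0 < k" "k \<le> n"
  obtains j where "(\<Sum>i<n. payment n k A B v i) = B (v j) + real (k - 1) * A (v j)"
proof -
  have "k - 1 \<in> rank_of n v ` {..<n}"
    using bij_betw_rank_of[of n v] assms by (simp add: bij_betw_def)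
  then obtain j where j: "j < n" "rank_of n v j = k - 1" by auto
  have eq: "rank_of n v i = k - Suc 0 \<longleftrightarrow> i = j" if "i < n" for i
    using bij_betw_rank_of[of n v] j that by (auto simp: bij_betw_def inj_on_def)
  have "(\<Sum>i<n. payment n k A B v i) =
      (\<Sum>i<n. (if i = j then B (v j) else 0) + of_bool (beats v i j) * A (v j))"
  proof (rule sum.cong[OF refl])
    fix i assume i: "i \<in> {..<n}"
    have "(\<Sum>l<n. of_bool (beats v i l \<and> rank_of n v l = k - 1) * A (v l)) =
        (\<Sum>l<n. if l = j then of_bool (beats v i j) * A (v j) else 0)"
      by (rule sum.cong) (use eq in auto)
    then show "payment n k A B v i = (if i = j then B (v j) else 0) + of_bool (beats v i j) * A (v j)"
      using i j by (auto simp: payment_def eq)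
  qed
  also have "\<dots> = B (v j) + (\<Sum>i<n. of_bool (beats v i j)) * A (v j)"
    using j by (simp add: sum.distrib sum_distrib_right)
  also have "(\<Sum>i<n. of_bool (beats v i j)) = real (k - 1)"
    using j(2) by (simp add: rank_of_def sum_of_bool_eq Int_def)
  finally show ?thesis by (rule that)
qed

lemma rank_of_fun_upd_self:
  "rank_of n (v(i := x)) i = card {l\<in>{..<n} - {i}. x < v l \<or> (v l = x \<and> l < i)}"
  unfolding rank_of_def by (rule arg_cong[of _ _ card]) (auto simp: beats_def)

text \<open>Bidder \<open>i\<close> accounts for one of those above \<open>j\<close>. So rank
  \<open>k - 1\<close> for \<open>j\<close> means that \<open>k - 2\<close> of the remaining
  \<open>n - 2\<close> bidders are above.\<close>

lemma rank_of_fun_upd_beaten: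
  assumes "i < n" "i \<noteq> j" "y < x \<or> (x = y \<and> i < j)"
  shows "rank_of n (v(j := y, i := x)) j = Suc (card {l\<in>{..<n} - {i, j}. y < v l \<or> (v l = y \<and> l < j)})"
proof -
  have "{l\<in>{..<n}. beats (v(j := y, i := x)) l j} =
      insert i {l\<in>{..<n} - {i, j}. y < v l \<or> (v l = y \<and> l < j)}"
    using assms by (auto simp: beats_def)
  then show ?thesis by (simp add: rank_of_def)
qed

section \<open>Interim expectations of ranks and payments\<close>

context regular_density
begin

lemma prob_space_profile: "prob_space (profile_measure n vbar f)"
  unfolding profile_measure_def by (intro prob_space_PiM V.prob_space_axioms)

lemma integral_PiM_count_above:
  assumes "finite I" "J \<subseteq> I" and y: "y \<in> {0..vbar}"
  shows "(\<integral>v. of_bool (card {l\<in>J. y < v l \<or> (v l = y \<and> b l)} = m) \<partial>PiM I (\<lambda>_. V)) =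
    real (card J choose m) * (1 - F y) ^ m * F y ^ (card J - m)"
proof -
  have eq: "{a. y < a \<or> (a = y \<and> b l)} = (if b l then {y..} else {y<..})" for l by auto
  have "{a. y < a \<or> (a = y \<and> b l)} \<in> V.events" for l unfolding eq by simp
  from V.integral_PiM_count[OF assms(1,2) this prob_V_above[OF y]] show ?thesis by simp
qed

lemma component_measurable [measurable]:
  "i < n \<Longrightarrow> (\<lambda>v. v i) \<in> profile_measure n vbar f \<rightarrow>\<^sub>M borel"
  unfolding profile_measure_def
  using measurable_component_singleton[of i "{..<n}" "\<lambda>_. V"] by (simp cong: measurable_cong_sets)

lemma beats_measurable [measurable]:
  assumes [simp]: "i < n" "j < n"
  shows "Measurable.pred (profile_measure n vbar f) (\<lambda>v. beats v i j)"
proof -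
  have "(\<lambda>v. v i) \<in> borel_measurable (profile_measure n vbar f)"
    "(\<lambda>v. v j) \<in> borel_measurable (profile_measure n vbar f)"
    by measurable
  note [measurable] = this
  have "beats v i j \<longleftrightarrow> v j < v i \<or> (\<not> v i < v j \<and> i < j)" for v
    by (auto simp: beats_def)
  then show ?thesis by simp
qed

lemma rank_of_measurable [measurable]:
  assumes [simp]: "i < n"
  shows "(\<lambda>v. rank_of n v i) \<in> profile_measure n vbar f \<rightarrow>\<^sub>M count_space UNIV"
  unfolding rank_of_def
proof (rule measurable_card)
  fix l
  show "{v \<in> space (profile_measure n vbar f). l \<in> {j \<in> {..<n}. beats v j i}}
      \<in> sets (profile_measure n vbar f)"
    by (cases "l < n") simp_all
qed

lemma fun_upd_measurable [measurable]:
  "i < n \<Longrightarrow> (\<lambda>v. v(i := x)) \<in> profile_measure n vbar f \<rightarrow>\<^sub>M profile_measure n vbar f"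
  unfolding profile_measure_def by (rule measurable_fun_upd[where J = "{..<n}"]) auto

lemma integrable_profile_bounded:
  fixes g :: "(nat \<Rightarrow> real) \<Rightarrow> real"
  assumes "g \<in> borel_measurable (profile_measure n vbar f)" "\<And>v. \<bar>g v\<bar> \<le> b"
  shows "integrable (profile_measure n vbar f) g"
proof -
  interpret prob_space "profile_measure n vbar f" by (rule prob_space_profile)
  show ?thesis using assms by (intro integrable_const_bound[of _ b]) auto
qed

lemma integrable_profile_fun_upd:
  fixes g :: "(nat \<Rightarrow> real) \<Rightarrow> real"
  assumes "g \<in> borel_measurable (profile_measure n vbar f)" "\<And>v. \<bar>g v\<bar> \<le> b" "i < n"
  shows "integrable (profile_measure n vbar f) (\<lambda>v. g (v(i := x)))"
  using assms by (intro integrable_profile_bounded measurable_compose[OF fun_upd_measurable]) auto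

lemma interim_rank_of:
  assumes "i < n" "x \<in> {0..vbar}"
  shows "interim (profile_measure n vbar f) (\<lambda>v. of_bool (rank_of n v i = m)) i x =
    real ((n - 1) choose m) * (1 - F x) ^ m * F x ^ (n - 1 - m)"
  unfolding interim_def rank_of_fun_upd_self profile_measure_def
  using integral_PiM_count_above[of "{..<n}" "{..<n} - {i}" x "\<lambda>l. l < i" m] assms by simp

text \<open>Closed form of the interim allocation on \<open>{0..vbar}\<close>: the chance that fewer
  than \<open>k\<close> of the \<open>n - 1\<close> opponents lie above \<open>x\<close>.\<close>

definition win_prob :: "nat \<Rightarrow> nat \<Rightarrow> real \<Rightarrow> real" where
  "win_prob n k x = (\<Sum>m<k. real ((n - 1) choose m) * (1 - F x) ^ m * F x ^ (n - 1 - m))"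

lemma interim_alloc_eq:
  assumes "i < n" "x \<in> {0..vbar}"
  shows "interim_alloc n k vbar f i x = win_prob n k x"
proof -
  have "interim_alloc n k vbar f i x =
      (\<integral>v. (\<Sum>m<k. of_bool (rank_of n (v(i := x)) i = m)) \<partial>profile_measure n vbar f)"
    unfolding interim_alloc_def interim_def
    by (rule Bochner_Integration.integral_cong) (use assms in \<open>auto simp: efficient_alloc_rank_of of_bool_def\<close>)
  also have "\<dots> = (\<Sum>m<k. \<integral>v. of_bool (rank_of n (v(i := x)) i = m) \<partial>profile_measure n vbar f)"
    using assms
    by (intro Bochner_Integration.integral_sum integrable_profile_fun_upd[where b = 1]) auto
  also have "\<dots> = win_prob n k x"
    unfolding win_prob_def using interim_rank_of[OF assms] by (simp add: interim_def)
  finally show ?thesis .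
qed

text \<open>Condition on the value y of \<open>j\<close>. Up to a null set \<open>i\<close> beats
  \<open>j\<close> iff y < x, and then \<open>j\<close> is the lowest winner iff exactly
  \<open>k - 2\<close> of the other \<open>n - 2\<close> values lie above y, a binomial
  event.\<close>

lemma interim_outranked_term:
  fixes A :: "real \<Rightarrow> real"
  assumes i: "i < n" and j: "j < n" "i \<noteq> j" and x: "x \<in> {0..vbar}" and k: "2 \<le> k"
    and A_meas: "A \<in> borel_measurable borel" and A_bound: "\<And>y. \<bar>A y\<bar> \<le> b"
    and A_int: "set_integrable lborel {0..x} (\<lambda>y. A y * F y ^ (n - k) * (1 - F y) ^ (k - 2) * f y)"
  shows "interim (profile_measure n vbar f) (\<lambda>v. of_bool (beats v i j \<and> rank_of n v j = k - 1) * A (v j)) i x =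
    real ((n - 2) choose (k - 2)) * integral {0..x} (\<lambda>y. A y * F y ^ (n - k) * (1 - F y) ^ (k - 2) * f y)"
proof -
  define g where "g v = of_bool (beats v i j \<and> rank_of n v j = k - 1) * A (v j)" for v
  define h where "h y = A y * F y ^ (n - k) * (1 - F y) ^ (k - 2)" for y
  have "g \<in> borel_measurable (profile_measure n vbar f)"
    unfolding g_def using A_meas i j by measurable
  then have int: "integrable (profile_measure n vbar f) (\<lambda>v. g (v(i := x)))"
    using A_bound order_trans[OF abs_ge_zero A_bound] i
    by (intro integrable_profile_fun_upd[where b = b]) (assumption | simp add: g_def)+
  \<comment> \<open>Only coordinate \<open>j\<close> is split off. Coordinate \<open>i\<close> stays
    in the inner product but is overwritten by \<open>x\<close>.\<close>
  have ins: "{..<n} = insert j ({..<n} - {j})" using j by auto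
  have "(\<integral>v. g (v(i := x)) \<partial>profile_measure n vbar f) =
      (\<integral>y. (\<integral>v. g (v(j := y, i := x)) \<partial>PiM ({..<n} - {j}) (\<lambda>_. V)) \<partial>V)"
    using V.integral_PiM_insert(2)[of j "{..<n} - {j}" "\<lambda>v. g (v(i := x))"] int ins
    by (simp add: profile_measure_def)
  also have "\<dots> = (\<integral>y. real ((n - 2) choose (k - 2)) * (indicator {0..x} y * h y) \<partial>V)"
  proof (rule integral_cong_AE)
    show "(\<lambda>y. \<integral>v. g (v(j := y, i := x)) \<partial>PiM ({..<n} - {j}) (\<lambda>_. V)) \<in> borel_measurable V"
      using V.integral_PiM_insert(1)[of j "{..<n} - {j}" "\<lambda>v. g (v(i := x))"] int ins
      by (simp add: profile_measure_def borel_measurable_integrable)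
    show "(\<lambda>y. real ((n - 2) choose (k - 2)) * (indicator {0..x} y * h y)) \<in> borel_measurable V"
    proof -
      have "integrable V (\<lambda>y. indicator {0..x} y * h y)"
        using integral_V(1)[OF x] A_int by (simp add: h_def)
      then show ?thesis
        by (intro borel_measurable_times[OF borel_measurable_const] borel_measurable_integrable)
    qed
    show "AE y in V. (\<integral>v. g (v(j := y, i := x)) \<partial>PiM ({..<n} - {j}) (\<lambda>_. V)) =
        real ((n - 2) choose (k - 2)) * (indicator {0..x} y * h y)"
      using AE_V_support AE_V_neq[of x]
    proof eventually_elim
      case (elim y)
      show ?case
      proof (cases "y < x")
        case False
        then have "g (v(j := y, i := x)) = 0" for v
          using elim j by (auto simp: g_def beats_def)
        then show ?thesis using False elim by simp
      next
        case True
        have card: "card ({..<n} - {i, j}) = n - 2"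
          using i j by (simp add: card_Diff_subset)
        have "g (v(j := y, i := x)) =
            A y * of_bool (card {l\<in>{..<n} - {i, j}. y < v l \<or> (v l = y \<and> l < j)} = k - 2)" for v
          using rank_of_fun_upd_beaten[OF i j(2), of y x v] True j k
          by (auto simp: g_def beats_def)
        then have "(\<integral>v. g (v(j := y, i := x)) \<partial>PiM ({..<n} - {j}) (\<lambda>_. V)) = A y *
            (\<integral>v. of_bool (card {l\<in>{..<n} - {i, j}. y < v l \<or> (v l = y \<and> l < j)} = k - 2) \<partial>PiM ({..<n} - {j}) (\<lambda>_. V))"
          by simp
        also have "\<dots> = A y * (real ((n - 2) choose (k - 2)) * (1 - F y) ^ (k - 2) * F y ^ (n - k))"
        proof -
          have "{..<n} - {i, j} \<subseteq> {..<n} - {j}" "n - 2 - (k - 2) = n - k" using k by auto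
          then show ?thesis
            using integral_PiM_count_above[of "{..<n} - {j}" "{..<n} - {i, j}" y "\<lambda>l. l < j" "k - 2"] elim(1)
            by (simp only: card finite_Diff finite_lessThan)
        qed
        finally show ?thesis using True elim by (simp add: h_def)
      qed
    qed
  qed
  also have "\<dots> = real ((n - 2) choose (k - 2)) * integral {0..x} (\<lambda>y. h y * f y)"
    using integral_V(2)[OF x] A_int by (simp add: h_def)
  finally show ?thesis by (simp add: interim_def g_def h_def)
qed

lemma payment_measurable [measurable]:
  assumes [measurable]: "A \<in> borel_measurable borel" "B \<in> borel_measurable borel" and i: "i < n"
  shows "(\<lambda>v. payment n k A B v i) \<in> borel_measurable (profile_measure n vbar f)"
proof -
  have "(\<lambda>v. of_bool (beats v i j \<and> rank_of n v j = k - 1) * A (v j)) \<in> borel_measurable (profile_measure n vbar f)"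
    if "j < n" for j
    using that i by measurable
  moreover have "(\<lambda>v. of_bool (rank_of n v i = k - 1) * B (v i)) \<in> borel_measurable (profile_measure n vbar f)"
    using i by measurable
  ultimately show ?thesis
    unfolding payment_def by (intro borel_measurable_add borel_measurable_sum) auto
qed

lemma payment_bounded:
  assumes "\<And>y. \<bar>A y\<bar> \<le> b" "\<And>y. \<bar>B y\<bar> \<le> b"
  shows "\<bar>payment n k A B v i\<bar> \<le> b + real n * b"
proof -
  have b: "0 \<le> b" using assms(1)[of 0] by linarith
  have "\<bar>of_bool (rank_of n v i = k - 1) * B (v i)\<bar> \<le> b"
    using assms b by auto
  moreover have "\<bar>\<Sum>j<n. of_bool (beats v i j \<and> rank_of n v j = k - 1) * A (v j)\<bar> \<le> (\<Sum>j<n. b)"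
    by (rule order_trans[OF sum_abs sum_mono]) (use assms b in auto)
  ultimately show ?thesis unfolding payment_def by simp
qed

text \<open>The first summand is \<open>B x\<close> times the chance of being the lowest winner; the
  second collects \<open>n - 1\<close> equal contributions, one for each opponent who may be the
  lowest winner.\<close>

lemma interim_payment:
  fixes A B :: "real \<Rightarrow> real"
  assumes i: "i < n" and x: "x \<in> {0..vbar}" and k: "2 \<le> k"
    and A_meas: "A \<in> borel_measurable borel" and A_bound: "\<And>y. \<bar>A y\<bar> \<le> b"
    and A_int: "set_integrable lborel {0..x} (\<lambda>y. A y * F y ^ (n - k) * (1 - F y) ^ (k - 2) * f y)"
    and B_meas: "B \<in> borel_measurable borel" and B_bound: "\<And>y. \<bar>B y\<bar> \<le> b"
  shows "interim (profile_measure n vbar f) (\<lambda>v. payment n k A B v i) i x =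
    real ((n - 1) choose (k - 1)) * B x * F x ^ (n - k) * (1 - F x) ^ (k - 1) +
    real (n - 1) * real ((n - 2) choose (k - 2)) *
      integral {0..x} (\<lambda>y. A y * F y ^ (n - k) * (1 - F y) ^ (k - 2) * f y)"
proof -
  let ?P = "profile_measure n vbar f"
  define g where "g j v = of_bool (beats v i j \<and> rank_of n v j = k - 1) * A (v j)" for j v
  have b: "0 \<le> b" using A_bound[of 0] by linarith
  have g_int: "integrable ?P (\<lambda>v. g j (v(i := x)))" if "j < n" for j
  proof (rule integrable_profile_fun_upd[where b = b, OF _ _ i])
    show "g j \<in> borel_measurable ?P"
      unfolding g_def using A_meas i that by measurable
  qed (use A_bound b in \<open>auto simp: g_def\<close>)
  have B_int: "integrable ?P (\<lambda>v. of_bool (rank_of n (v(i := x)) i = k - 1) * B x)"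
    using i integrable_profile_fun_upd[where b = 1 and g = "\<lambda>v. of_bool (rank_of n v i = k - 1)"] by simp
  have g_val: "(\<integral>v. g j (v(i := x)) \<partial>?P) = (if j = i then 0 else
      real ((n - 2) choose (k - 2)) * integral {0..x} (\<lambda>y. A y * F y ^ (n - k) * (1 - F y) ^ (k - 2) * f y))"
    if "j < n" for j
  proof (cases "j = i")
    case True
    then show ?thesis by (simp add: g_def beats_def)
  next
    case False
    then show ?thesis
      using interim_outranked_term[OF i that _ x k A_meas A_bound A_int] by (simp add: interim_def g_def)
  qed
  have "interim ?P (\<lambda>v. payment n k A B v i) i x =
      (\<integral>v. of_bool (rank_of n (v(i := x)) i = k - 1) * B x + (\<Sum>j<n. g j (v(i := x))) \<partial>?P)"
    by (simp add: interim_def payment_def g_def)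
  also have "\<dots> = (\<integral>v. of_bool (rank_of n (v(i := x)) i = k - 1) \<partial>?P) * B x + (\<Sum>j<n. \<integral>v. g j (v(i := x)) \<partial>?P)"
    using B_int g_int by (subst Bochner_Integration.integral_add) auto
  also have "(\<integral>v. of_bool (rank_of n (v(i := x)) i = k - 1) \<partial>?P) =
      real ((n - 1) choose (k - 1)) * (1 - F x) ^ (k - 1) * F x ^ (n - k)"
    using interim_rank_of[OF i x, of "k - 1"] k by (simp add: interim_def)
  also have "(\<Sum>j<n. \<integral>v. g j (v(i := x)) \<partial>?P) = (\<Sum>j\<in>{..<n} - {i}.
      real ((n - 2) choose (k - 2)) * integral {0..x} (\<lambda>y. A y * F y ^ (n - k) * (1 - F y) ^ (k - 2) * f y))"
    using i by (subst sum.remove[of _ i]) (auto simp: g_val intro!: sum.cong)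
  finally show ?thesis using i by (simp add: mult_ac)
qed

section \<open>Monotonicity of the allocation and incentive compatibility\<close>

lemma win_prob_deriv:
  assumes "k \<noteq> 0" "k < n" and x: "x \<in> {0..vbar}"
  shows "(win_prob n k has_real_derivative
    real ((n - 1) choose (k - 1)) * real (n - k) * (1 - F x) ^ (k - 1) * F x ^ (n - k - 1) * f x)
    (at x within {0..vbar})"
proof -
  obtain k' where k': "k = Suc k'" using assms by (cases k) auto
  show ?thesis
    using DERIV_chain2[OF binomial_tail_deriv F_deriv[OF x], of k' "n - 1"] assms
    by (simp add: win_prob_def[abs_def] k')
qed

lemma win_prob_mono:
  assumes k: "k \<noteq> 0" "k < n" and xy: "0 \<le> x" "x \<le> y" "y \<le> vbar"
  shows "win_prob n k x \<le> win_prob n k y"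
proof (cases "x = y")
  case False
  obtain \<xi> where \<xi>: "x < \<xi>" "\<xi> < y" "win_prob n k y - win_prob n k x =
      real ((n - 1) choose (k - 1)) * real (n - k) * (1 - F \<xi>) ^ (k - 1) * F \<xi> ^ (n - k - 1) * f \<xi> * (y - x)"
    by (rule mvt_real_within[OF _ _ win_prob_deriv[OF k], of x y]) (use xy False in auto)
  have "0 \<le> real ((n - 1) choose (k - 1)) * real (n - k) * (1 - F \<xi>) ^ (k - 1) * F \<xi> ^ (n - k - 1) * f \<xi> * (y - x)"
    using F_bounds[of \<xi>] f_pos[of \<xi>] \<xi> xy by (intro mult_nonneg_nonneg zero_le_power) auto
  then show ?thesis using \<xi> by linarith
qed simp

lemma win_prob_nonneg: "x \<in> {0..vbar} \<Longrightarrow> 0 \<le> win_prob n k x"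
  unfolding win_prob_def using F_bounds[of x]
  by (intro sum_nonneg mult_nonneg_nonneg zero_le_power) auto

text \<open>The integral of the nondecreasing winning probability is convex, hence lies above its
  tangent at \<open>y\<close>. This is the incentive constraint for type \<open>x\<close> reporting
  \<open>y\<close>.\<close>

lemma win_prob_integral_convex:
  assumes k: "k \<noteq> 0" "k < n" and xy: "x \<in> {0..vbar}" "y \<in> {0..vbar}"
  shows "integral {0..y} (win_prob n k) + (x - y) * win_prob n k y \<le> integral {0..x} (win_prob n k)"
proof -
  let ?G = "\<lambda>x. integral {0..x} (win_prob n k)"
  have cont: "continuous_on {0..vbar} (win_prob n k)"
    by (rule DERIV_continuous_on[OF win_prob_deriv[OF k]])
  note deriv = integral_has_real_derivative[OF cont]
  consider "x = y" | "y < x" | "x < y" by linarith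
  then show ?thesis
  proof cases
    case 2
    obtain \<xi> where "y < \<xi>" "\<xi> < x" "?G x - ?G y = win_prob n k \<xi> * (x - y)"
      by (rule mvt_real_within[OF 2 _ deriv]) (use xy in auto)
    moreover then have "win_prob n k y * (x - y) \<le> win_prob n k \<xi> * (x - y)"
      using xy by (intro mult_right_mono win_prob_mono k) auto
    ultimately show ?thesis by (simp add: algebra_simps)
  next
    case 3
    obtain \<xi> where "x < \<xi>" "\<xi> < y" "?G y - ?G x = win_prob n k \<xi> * (y - x)"
      by (rule mvt_real_within[OF 3 _ deriv]) (use xy in auto)
    moreover then have "win_prob n k \<xi> * (y - x) \<le> win_prob n k y * (y - x)"
      using xy by (intro mult_right_mono win_prob_mono k) auto
    ultimately show ?thesis by (simp add: algebra_simps)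
  qed simp
qed

lemma z_fun_eq:
  assumes "i < n" "x \<in> {0..vbar}"
  shows "z_fun n k vbar f i x = x * win_prob n k x - integral {0..x} (win_prob n k)"
proof -
  have "integral {0..x} (interim_alloc n k vbar f i) = integral {0..x} (win_prob n k)"
    using assms by (intro integral_cong interim_alloc_eq) auto
  then show ?thesis using assms by (simp add: z_fun_def interim_alloc_eq)
qed

text \<open>Inserting \<open>z_fun\<close> into the utility of type \<open>x\<close> reporting
  \<open>y\<close> yields the tangent at \<open>y\<close> to the integrated winning probability; for
  \<open>x = y\<close> it is the truthful utility.\<close>

lemma interim_utility:
  assumes i: "i < n" and y: "y \<in> {0..vbar}"
    and P: "integrable (profile_measure n vbar f) (\<lambda>v. P (v(i := y)) i)"
      "interim (profile_measure n vbar f) (\<lambda>v. P v i) i y = z_fun n k vbar f i y"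
  shows "interim (profile_measure n vbar f) (\<lambda>v. x * efficient_alloc n k v i - P v i) i y =
    integral {0..y} (win_prob n k) + (x - y) * win_prob n k y"
proof -
  let ?M = "profile_measure n vbar f"
  have "integrable ?M (\<lambda>v. efficient_alloc n k (v(i := y)) i)"
    using i by (intro integrable_profile_fun_upd[where b = 1]) (auto simp: efficient_alloc_rank_of)
  then have "interim ?M (\<lambda>v. x * efficient_alloc n k v i - P v i) i y =
      x * interim_alloc n k vbar f i y - interim ?M (\<lambda>v. P v i) i y"
    using P(1) by (simp add: interim_def interim_alloc_def)
  then show ?thesis
    using i y P(2) by (simp add: interim_alloc_eq z_fun_eq algebra_simps)
qed


section \<open>Assembling the payment rule\<close>

lemma implementing_payment_exists:
  assumes k: "2 \<le> k" "k < n"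
  shows "\<exists>P :: (nat \<Rightarrow> real) \<Rightarrow> nat \<Rightarrow> real.
    (\<forall>v i. 0 \<le> P v i) \<and> implements_efficient n k vbar f P \<and> interim_IR n k vbar f P \<and>
    (\<forall>v. \<forall>i<n. efficient_alloc n k v i = 0 \<longrightarrow> P v i = 0) \<and>
    (\<exists>c. \<forall>v. (\<Sum>i<n. P v i) = c)"
proof -
  define C where "C = real ((n - 1) choose (k - 1))"
  define z where "z x = x * win_prob n k x - integral {0..x} (win_prob n k)" for x
  have nk: "n - k = Suc (n - k - 1)" "k - 1 = Suc (k - 2)" and k0: "k \<noteq> 0" using k by auto
  have C_pos: "0 < C" using k by (simp add: C_def)
  have win_cont: "continuous_on {0..vbar} (win_prob n k)"
    by (rule DERIV_continuous_on[OF win_prob_deriv[OF k0 k(2)]])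
  \<comment> \<open>The two terms with \<open>win_prob\<close> itself cancel, leaving
    \<open>x\<close> times its derivative. This matches the payment equation with r = n - k - 1, s =
    k - 2 and c = C (n - k).\<close>
  have z_deriv: "(z has_real_derivative
      (C * real (n - k)) * x * F x ^ (n - k - 1) * (1 - F x) ^ Suc (k - 2) * f x) (at x within {0..vbar})"
    if x: "x \<in> {0..vbar}" for x
    unfolding z_def nk(2)[symmetric]
    by (rule derivative_eq_intros win_prob_deriv[OF k0 k(2) x] integral_has_real_derivative[OF win_cont x] refl)+
      (simp add: C_def mult_ac)
  obtain B R where B: "B \<in> borel_measurable borel" "\<And>y. 0 \<le> B y" "\<And>y. B y \<le> R"
    and int: "\<And>x. x \<in> {0..vbar} \<Longrightarrow>
      set_integrable lborel {0..x} (\<lambda>y. (R - B y) * F y ^ (n - k) * (1 - F y) ^ (k - 2) * f y)"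
    and eq: "\<And>x. x \<in> {0..vbar} \<Longrightarrow>
      C * B x * F x ^ (n - k) * (1 - F x) ^ (k - 1) +
      C * integral {0..x} (\<lambda>y. (R - B y) * F y ^ (n - k) * (1 - F y) ^ (k - 2) * f y) = z x"
    using lowest_winner_payment_exists[OF C_pos _ _ z_deriv] C_pos k
    unfolding nk[symmetric] by (auto simp: z_def)
  \<comment> \<open>Each of the other \<open>k - 1\<close> winners bears an equal share of what
    \<open>B\<close> leaves of the constant revenue \<open>R\<close>; \<open>B \<le> R\<close> makes
    the share nonnegative.\<close>
  define A where "A y = (R - B y) / real (k - 1)" for y
  define P where "P = payment n k A B"
  have R: "0 \<le> R" using B(2,3)[of 0] by linarith
  have A_nonneg: "0 \<le> A y" for y using B(3)[of y] by (simp add: A_def)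
  have A_le: "A y \<le> R" for y
  proof -
    have "A y \<le> (R - B y) / 1"
      unfolding A_def using B(3)[of y] k by (intro divide_left_mono) auto
    then show ?thesis using B(2)[of y] by simp
  qed
  have A_meas: "A \<in> borel_measurable borel" unfolding A_def using B(1) by measurable
  have bounds: "\<bar>A y\<bar> \<le> R" "\<bar>B y\<bar> \<le> R" for y
    using A_nonneg[of y] A_le[of y] B(2,3)[of y] by auto
  have A_eq: "A y * F y ^ (n - k) * (1 - F y) ^ (k - 2) * f y =
      (1 / real (k - 1)) * ((R - B y) * F y ^ (n - k) * (1 - F y) ^ (k - 2) * f y)" for y
    by (simp add: A_def)
  have P_meas: "(\<lambda>v. P v i) \<in> borel_measurable (profile_measure n vbar f)" if "i < n" for i
    unfolding P_def using A_meas B(1) that by (rule payment_measurable)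
  have P_int: "integrable (profile_measure n vbar f) (\<lambda>v. P (v(i := x)) i)" if "i < n" for i x
    by (rule integrable_profile_fun_upd[OF P_meas[OF that] _ that])
      (unfold P_def, rule payment_bounded[OF bounds])
  have P_interim: "interim (profile_measure n vbar f) (\<lambda>v. P v i) i x = z_fun n k vbar f i x"
    if i: "i < n" and x: "x \<in> {0..vbar}" for i x
  proof -
    let ?I = "integral {0..x} (\<lambda>y. (R - B y) * F y ^ (n - k) * (1 - F y) ^ (k - 2) * f y)"
    have A_int: "set_integrable lborel {0..x} (\<lambda>y. A y * F y ^ (n - k) * (1 - F y) ^ (k - 2) * f y)"
      unfolding A_eq using int[OF x] by (intro set_integrable_mult_right) auto
    have "integral {0..x} (\<lambda>y. A y * F y ^ (n - k) * (1 - F y) ^ (k - 2) * f y) = 1 / real (k - 1) * ?I"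
      unfolding A_eq by (rule integral_mult_right)
    \<comment> \<open>By this identity the \<open>n - 1\<close> opponents' terms, together with the
      factor 1 / (k - 1) in \<open>A\<close>, have total coefficient exactly \<open>C\<close>, as in
      the equation solved by \<open>B\<close>.\<close>
    moreover have "(k - 1) * ((n - 1) choose (k - 1)) = (n - 1) * ((n - 2) choose (k - 2))"
      using binomial_absorption[of "k - 2" "n - 1"]
      unfolding nk(2)[symmetric] by (simp only: diff_diff_left one_add_one)
    then have "real (n - 1) * real ((n - 2) choose (k - 2)) = real (k - 1) * C"
      unfolding C_def by (metis of_nat_mult)
    ultimately have "real (n - 1) * real ((n - 2) choose (k - 2)) *
        integral {0..x} (\<lambda>y. A y * F y ^ (n - k) * (1 - F y) ^ (k - 2) * f y) = C * ?I"
      using k by simp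
    then show ?thesis
      unfolding P_def interim_payment[OF i x k(1) A_meas bounds(1) A_int B(1) bounds(2)] z_fun_eq[OF i x]
      using eq[OF x] by (simp add: C_def z_def)
  qed
  have utility: "interim (profile_measure n vbar f) (\<lambda>v. x * efficient_alloc n k v i - P v i) i y =
      integral {0..y} (win_prob n k) + (x - y) * win_prob n k y"
    if "i < n" "y \<in> {0..vbar}" for i x y
    using interim_utility[where P = P, OF that P_int[OF that(1)] P_interim[OF that]] .
  have "implements_efficient n k vbar f P"
    unfolding implements_efficient_def
    using P_meas P_int P_interim win_prob_integral_convex[OF k0 k(2)] by (simp add: utility)
  moreover have "0 \<le> integral {0..x} (win_prob n k)" if "x \<in> {0..vbar}" for x
    using that win_prob_nonneg
    by (intro integral_nonneg integrable_continuous_real continuous_on_subset[OF win_cont]) auto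
  then have "interim_IR n k vbar f P"
    unfolding interim_IR_def by (simp add: utility)
  moreover have "(\<Sum>i<n. P v i) = R" for v
  proof -
    obtain j where "(\<Sum>i<n. P v i) = B (v j) + real (k - 1) * A (v j)"
      unfolding P_def using sum_payment[of k n A B v] k by auto
    then show ?thesis using k by (simp add: A_def)
  qed
  moreover have "0 \<le> P v i" for v i
    unfolding P_def by (rule payment_nonneg[OF A_nonneg B(2)])
  moreover have "P v i = 0" if "i < n" "efficient_alloc n k v i = 0" for v i
    unfolding P_def using that k by (intro payment_loser) auto
  ultimately show ?thesis by blast
qed

end

theorem mainTheorem12:
  fixes n k :: nat and vbar :: real and f :: "real \<Rightarrow> real"
  assumes vbar_pos: "0 < vbar"
    and f_pos: "\<forall>x\<in>{0..vbar}. 0 < f x"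
    and f_C1: "\<exists>f'. continuous_on {0..vbar} f' \<and>
                 (\<forall>x\<in>{0..vbar}. (f has_real_derivative f' x) (at x within {0..vbar}))"
    and f_density: "integral {0..vbar} f = 1"
    and reg: "regular vbar f"
    and k_ge: "2 \<le> k" and k_lt: "k < n"
  shows "\<exists>P :: (nat \<Rightarrow> real) \<Rightarrow> nat \<Rightarrow> real.
           (\<forall>v. (\<forall>j<n. v j \<in> {0..vbar}) \<longrightarrow> (\<forall>i<n. 0 \<le> P v i)) \<and>
           implements_efficient n k vbar f P \<and>
           interim_IR n k vbar f P \<and>
           (\<forall>v. (\<forall>j<n. v j \<in> {0..vbar}) \<longrightarrow> (\<forall>i<n. efficient_alloc n k v i = 0 \<longrightarrow> P v i = 0)) \<and>
           (\<exists>c. AE v in profile_measure n vbar f. (\<Sum>i<n. P v i) = c)"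
proof -
  have "continuous_on {0..vbar} f"
    using f_C1 by (auto intro: DERIV_continuous_on)
  then interpret regular_density vbar f
    using assms by unfold_locales auto
  obtain P c where "\<forall>v i. 0 \<le> P v i" "implements_efficient n k vbar f P" "interim_IR n k vbar f P"
    "\<forall>v. \<forall>i<n. efficient_alloc n k v i = 0 \<longrightarrow> P v i = 0" "\<forall>v. (\<Sum>i<n. P v i) = c"
    using implementing_payment_exists[OF k_ge k_lt] by blast
  then show ?thesis by (intro exI[of _ P]) auto
qed

end
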